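(* For any topological space $X$ and $x_0\in X$, the fundamental group $\pi_1^{\mathrm{pSpan}}(X,x_0)$ equipped with the path Spanier topology is a topological group.
   Context: Let $P(X,x_0)$ be the set of paths in $X$ starting at $x_0$. A path open cover is a family $\mathcal V=\{V_\alpha\mid\alpha\in P(X,x_0)\}$ of open subsets of $X$ with $\alpha(1)\in V_\alpha$. The path Spanier subgroup $\widetilde\pi(\mathcal V,x_0)$ is the subgroup of $\pi_1(X,x_0)$ consisting of all classes with a representative of the form $\prod_{j=1}^n\alpha_j*\beta_j*\alpha_j^{-1}$, where $\alpha_j\in P(X,x_0)$ and $\beta_j$ is a loop based at $\alpha_j(1)$ lying in $V_{\alpha_j}$. The path Spanier topology on $\pi_1(X,x_0)$ is the topology having as a basis all left cosets $g\,\widetilde\pi(\mathcal V,x_0)$, where $g\in\pi_1(X,x_0)$ and $\mathcal V$ is a path open cover; the resulting space is denoted $\pi_1^{\mathrm{pSpan}}(X,x_0)$. A topological group is a group with a topology for which multiplication and inversion are continuous (no separation axiom is assumed). *)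

theory Defs
  imports "HOL-Analysis.Analysis" "HOL-Algebra.Coset"
begin

text \<open>
  A path is a continuous map out of the unit interval. It is represented by a function on the
  reals that is \<open>undefined\<close> outside the interval, so that equality of paths is equality of
  functions. This matters below, where families are indexed by paths. The library constants
  \<open>joinpaths\<close>, \<open>reversepath\<close> and \<open>homotopic_paths\<close> are
  restricted to the type class of topological spaces; the versions here work in an arbitrary
  \<^typ>\<open>'a topology\<close>.
\<close>

definition paths_from :: "'a topology \<Rightarrow> 'a \<Rightarrow> (real \<Rightarrow> 'a) set"
  where "paths_from X x0 = {\<alpha> \<in> extensional {0..1}. pathin X \<alpha> \<and> \<alpha> 0 = x0}"

definition loops_at :: "'a topology \<Rightarrow> 'a \<Rightarrow> (real \<Rightarrow> 'a) set"
  where "loops_at X x = {\<beta> \<in> paths_from X x. \<beta> 1 = x}"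

definition const_path :: "'a \<Rightarrow> real \<Rightarrow> 'a"
  where "const_path x = restrict (\<lambda>t. x) {0..1}"

definition path_concat :: "(real \<Rightarrow> 'a) \<Rightarrow> (real \<Rightarrow> 'a) \<Rightarrow> real \<Rightarrow> 'a"  (infixr \<open>\<star>\<close> 75)
  where "p \<star> q = restrict (\<lambda>t. if t \<le> 1/2 then p (2 * t) else q (2 * t - 1)) {0..1}"

definition path_reverse :: "(real \<Rightarrow> 'a) \<Rightarrow> real \<Rightarrow> 'a"
  where "path_reverse p = restrict (\<lambda>t. p (1 - t)) {0..1}"

definition path_homotopic :: "'a topology \<Rightarrow> (real \<Rightarrow> 'a) \<Rightarrow> (real \<Rightarrow> 'a) \<Rightarrow> bool"
  where "path_homotopic X p q \<longleftrightarrow>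
    homotopic_with (\<lambda>r. r 0 = p 0 \<and> r 1 = p 1) (subtopology euclideanreal {0..1}) X p q"

definition loop_class :: "'a topology \<Rightarrow> 'a \<Rightarrow> (real \<Rightarrow> 'a) \<Rightarrow> (real \<Rightarrow> 'a) set"
  where "loop_class X x0 p = {q \<in> loops_at X x0. path_homotopic X p q}"

text \<open>The union in the multiplication ranges over all representatives; as concatenation respects
  homotopy, all of its members are the same class.\<close>

definition fundamental_group :: "'a topology \<Rightarrow> 'a \<Rightarrow> (real \<Rightarrow> 'a) set monoid"
  where "fundamental_group X x0 =
    \<lparr>carrier = loop_class X x0 ` loops_at X x0,
     mult = (\<lambda>A B. \<Union>p\<in>A. \<Union>q\<in>B. loop_class X x0 (p \<star> q)),
     one = loop_class X x0 (const_path x0)\<rparr>"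

text \<open>Only the values of \<open>V\<close> on \<open>paths_from X x0\<close> are relevant.\<close>

definition path_open_cover :: "'a topology \<Rightarrow> 'a \<Rightarrow> ((real \<Rightarrow> 'a) \<Rightarrow> 'a set) \<Rightarrow> bool"
  where "path_open_cover X x0 V \<longleftrightarrow>
    (\<forall>\<alpha> \<in> paths_from X x0. openin X (V \<alpha>) \<and> \<alpha> 1 \<in> V \<alpha>)"

text \<open>The loops \<open>\<alpha>\<^sub>1 \<star> \<beta>\<^sub>1 \<star> \<alpha>\<^sub>1\<inverse> \<star> \<dots> \<star> \<alpha>\<^sub>n \<star> \<beta>\<^sub>n \<star> \<alpha>\<^sub>n\<inverse>\<close>
  with \<open>n \<ge> 1\<close>, the product of the \<open>n\<close> factors being bracketed to the right.\<close>

inductive_set path_spanier_loops ::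
    "'a topology \<Rightarrow> 'a \<Rightarrow> ((real \<Rightarrow> 'a) \<Rightarrow> 'a set) \<Rightarrow> (real \<Rightarrow> 'a) set"
  for X :: "'a topology" and x0 :: 'a and V :: "(real \<Rightarrow> 'a) \<Rightarrow> 'a set"
  where
    single: "\<lbrakk>\<alpha> \<in> paths_from X x0; \<beta> \<in> loops_at X (\<alpha> 1); \<beta> ` {0..1} \<subseteq> V \<alpha>\<rbrakk>
      \<Longrightarrow> \<alpha> \<star> \<beta> \<star> path_reverse \<alpha> \<in> path_spanier_loops X x0 V"
  | prod: "\<lbrakk>\<alpha> \<in> paths_from X x0; \<beta> \<in> loops_at X (\<alpha> 1); \<beta> ` {0..1} \<subseteq> V \<alpha>;
        \<gamma> \<in> path_spanier_loops X x0 V\<rbrakk>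
      \<Longrightarrow> (\<alpha> \<star> \<beta> \<star> path_reverse \<alpha>) \<star> \<gamma> \<in> path_spanier_loops X x0 V"

definition path_spanier_subgroup ::
    "'a topology \<Rightarrow> 'a \<Rightarrow> ((real \<Rightarrow> 'a) \<Rightarrow> 'a set) \<Rightarrow> (real \<Rightarrow> 'a) set set"
  where "path_spanier_subgroup X x0 V = loop_class X x0 ` path_spanier_loops X x0 V"

definition path_spanier_basis :: "'a topology \<Rightarrow> 'a \<Rightarrow> (real \<Rightarrow> 'a) set set set"
  where "path_spanier_basis X x0 =
    {g <#\<^bsub>fundamental_group X x0\<^esub> path_spanier_subgroup X x0 V | g V.
      g \<in> carrier (fundamental_group X x0) \<and> path_open_cover X x0 V}"

definition path_spanier_topology :: "'a topology \<Rightarrow> 'a \<Rightarrow> (real \<Rightarrow> 'a) set topology"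
  where "path_spanier_topology X x0 =
    topology (arbitrary union_of (\<lambda>B. B \<in> path_spanier_basis X x0))"

definition topological_group :: "('g, 'm) monoid_scheme \<Rightarrow> 'g topology \<Rightarrow> bool"
  where "topological_group G T \<longleftrightarrow>
    group G \<and> topspace T = carrier G \<and>
    continuous_map (prod_topology T T) T (\<lambda>(x, y). x \<otimes>\<^bsub>G\<^esub> y) \<and>
    continuous_map T T (\<lambda>x. inv\<^bsub>G\<^esub> x)"

end

theory Submission
  imports Defs
begin

text \<open>
  The left cosets of a downward directed family of subgroups form the basis of a topology in
  which left translations are continuous; moving one factor past another requires conjugation.
  If every conjugate of a member of the family contains a member, then multiplication and inversion
  are continuous, because
  \<open>(x k)(y h) = x y (y\<inverse> k y) h\<close> and \<open>(x k)\<inverse> = x\<inverse> (x k\<inverse> x\<inverse>)\<close>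
  (\<open>topological_group_left_coset_topology\<close>).

  Path Spanier subgroups satisfy this criterion. They are directed, since path open covers can be
  intersected memberwise. For conjugation, let \<open>\<gamma>\<close> be a loop. Conjugating the lasso
  \<open>\<alpha> \<star> \<beta> \<star> \<alpha>\<inverse>\<close> by \<open>\<gamma>\<close> gives, up to homotopy, the lasso with the same loop
  \<open>\<beta>\<close> along the path \<open>\<gamma> \<star> \<alpha>\<close>. Both paths have the same endpoint, so
  \<open>\<alpha> \<mapsto> V (\<gamma> \<star> \<alpha>)\<close> is again a path open cover, and its subgroup is conjugated by
  \<open>\<gamma>\<close> into that of \<open>V\<close> (\<open>conjugate_path_spanier_subgroup\<close>). As the cover
  may assign different sets to paths with the same endpoint, the two subgroups differ in general.

  The group structure itself rests on one homotopy: two reparametrizations of a path with the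
  same endpoints are homotopic by a linear homotopy of the parameters
  (\<open>path_homotopic_reparametrization\<close>). Associativity, the unit law and the inverse law are all
  instances of it.
\<close>

section \<open>Topologies given by subgroups\<close>

text \<open>
  Two cosets that meet, \<open>g H\<close> and \<open>k K\<close>, contain \<open>u (H \<inter> K)\<close> for every common point
  \<open>u\<close>, as \<open>u H = g H\<close> and \<open>u K = k K\<close>; this is how directedness makes the cosets a basis.
  It also allows neighbourhoods of a point to be taken as cosets of that point.
\<close>

lemma openin_left_coset_topology:
  fixes G (structure)
  assumes "group G"
    and sub: "\<And>H. H \<in> N \<Longrightarrow> subgroup H G"
    and dir: "\<And>H K. H \<in> N \<Longrightarrow> K \<in> N \<Longrightarrow> \<exists>L \<in> N. L \<subseteq> H \<inter> K"
  shows "openin (topology (arbitrary union_of (\<lambda>B. B \<in> {g <#\<^bsub>G\<^esub> H | g H. g \<in> carrier G \<and> H \<in> N}))) U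
    \<longleftrightarrow> U \<subseteq> carrier G \<and> (\<forall>u \<in> U. \<exists>H \<in> N. u <#\<^bsub>G\<^esub> H \<subseteq> U)"
proof -
  interpret group G by fact
  define opn where "opn U \<longleftrightarrow> U \<subseteq> carrier G \<and> (\<forall>u \<in> U. \<exists>H \<in> N. u <#\<^bsub>G\<^esub> H \<subseteq> U)" for U
  let ?B = "{g <#\<^bsub>G\<^esub> H | g H. g \<in> carrier G \<and> H \<in> N}"
  have eq: "(arbitrary union_of (\<lambda>B. B \<in> ?B)) = opn"
  proof (intro ext iffI)
    fix U
    assume "(arbitrary union_of (\<lambda>B. B \<in> ?B)) U"
    then obtain \<U> where \<U>: "\<U> \<subseteq> ?B" "\<Union>\<U> = U"
      by (auto simp: union_of_def arbitrary_def)
    show "opn U"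
      unfolding opn_def
    proof (intro conjI ballI)
      show "U \<subseteq> carrier G"
        using \<U> sub l_coset_subset_G[OF subgroup.subset] by blast
      fix u assume "u \<in> U"
      then obtain g H where g: "g \<in> carrier G" "H \<in> N" "u \<in> g <#\<^bsub>G\<^esub> H" "g <#\<^bsub>G\<^esub> H \<subseteq> U"
        using \<U> by blast
      then have "u <#\<^bsub>G\<^esub> H = g <#\<^bsub>G\<^esub> H"
        using sub l_repr_independence by blast
      then show "\<exists>H \<in> N. u <#\<^bsub>G\<^esub> H \<subseteq> U" using g by auto
    qed
  next
    fix U assume U: "opn U"
    define \<U> where "\<U> = {g <#\<^bsub>G\<^esub> H | g H. g \<in> U \<and> H \<in> N \<and> g <#\<^bsub>G\<^esub> H \<subseteq> U}"
    have mem: "u \<in> u <#\<^bsub>G\<^esub> H" if "u \<in> U" "H \<in> N" for u H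
    proof -
      have "u \<in> carrier G" using that U by (auto simp: opn_def)
      then show ?thesis using subgroup.one_closed[OF sub[OF that(2)]] by (force simp: l_coset_def)
    qed
    have "\<Union>\<U> = U"
    proof
      show "\<Union>\<U> \<subseteq> U" by (auto simp: \<U>_def)
      show "U \<subseteq> \<Union>\<U>"
      proof
        fix u assume "u \<in> U"
        then obtain H where "H \<in> N" "u <#\<^bsub>G\<^esub> H \<subseteq> U" using U opn_def by blast
        then show "u \<in> \<Union>\<U>" using mem \<open>u \<in> U\<close> unfolding \<U>_def by blast
      qed
    qed
    moreover have "\<U> \<subseteq> ?B" using U by (auto simp: \<U>_def opn_def)
    ultimately show "(arbitrary union_of (\<lambda>B. B \<in> ?B)) U"
      by (auto simp: union_of_def arbitrary_def)
  qed
  have "istopology opn"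
    unfolding istopology_def
  proof (intro conjI allI impI)
    fix S T assume "opn S" "opn T"
    show "opn (S \<inter> T)"
      unfolding opn_def
    proof (intro conjI ballI)
      show "S \<inter> T \<subseteq> carrier G" using \<open>opn S\<close> by (auto simp: opn_def)
      fix u assume u: "u \<in> S \<inter> T"
      then obtain H K where "H \<in> N" "K \<in> N" "u <#\<^bsub>G\<^esub> H \<subseteq> S" "u <#\<^bsub>G\<^esub> K \<subseteq> T"
        using \<open>opn S\<close> \<open>opn T\<close> unfolding opn_def by blast
      moreover from this obtain L where "L \<in> N" "L \<subseteq> H \<inter> K" using dir by meson
      moreover from this have "u <#\<^bsub>G\<^esub> L \<subseteq> u <#\<^bsub>G\<^esub> H" "u <#\<^bsub>G\<^esub> L \<subseteq> u <#\<^bsub>G\<^esub> K"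
        by (auto simp: l_coset_def)
      ultimately show "\<exists>H \<in> N. u <#\<^bsub>G\<^esub> H \<subseteq> S \<inter> T" by blast
    qed
  next
    fix \<K> assume "\<forall>K \<in> \<K>. opn K"
    then show "opn (\<Union>\<K>)" unfolding opn_def by (meson Sup_least UnionE Union_upper order_trans)
  qed
  then show ?thesis
    unfolding eq by (simp only: topology_inverse' opn_def)
qed

text \<open>
  The conjugation hypothesis is what lets a perturbation of the left factor of a product be moved
  past the right factor.
\<close>

lemma topological_group_left_coset_topology:
  fixes G (structure)
  assumes "group G" and "N \<noteq> {}"
    and sub: "\<And>H. H \<in> N \<Longrightarrow> subgroup H G"
    and dir: "\<And>H K. H \<in> N \<Longrightarrow> K \<in> N \<Longrightarrow> \<exists>L \<in> N. L \<subseteq> H \<inter> K"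
    and conj: "\<And>g H. g \<in> carrier G \<Longrightarrow> H \<in> N \<Longrightarrow> \<exists>K \<in> N. \<forall>k \<in> K. g \<otimes> k \<otimes> inv g \<in> H"
  shows "topological_group G
    (topology (arbitrary union_of (\<lambda>B. B \<in> {g <#\<^bsub>G\<^esub> H | g H. g \<in> carrier G \<and> H \<in> N})))"
proof -
  interpret group G by fact
  define T where "T = topology (arbitrary union_of
      (\<lambda>B. B \<in> {g <#\<^bsub>G\<^esub> H | g H. g \<in> carrier G \<and> H \<in> N}))"
  have openT: "openin T U \<longleftrightarrow> U \<subseteq> carrier G \<and> (\<forall>u \<in> U. \<exists>H \<in> N. u <#\<^bsub>G\<^esub> H \<subseteq> U)" for U
    unfolding T_def by (rule openin_left_coset_topology) (use assms in auto)
  have coset_open: "openin T (g <#\<^bsub>G\<^esub> H)" if "g \<in> carrier G" "H \<in> N" for g H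
    unfolding openT
    using that sub l_repr_independence l_coset_subset_G[OF subgroup.subset] by (metis subset_refl)
  have coset_self: "g \<in> g <#\<^bsub>G\<^esub> H" if "g \<in> carrier G" "H \<in> N" for g H
    using that subgroup.one_closed[OF sub[OF that(2)]] by (force simp: l_coset_def)
  have coset_mem: "g \<otimes> h \<in> g <#\<^bsub>G\<^esub> H" if "h \<in> H" for g h H
    using that by (auto simp: l_coset_def)
  have inG: "h \<in> carrier G" if "h \<in> H" "H \<in> N" for h H
    using subgroup.mem_carrier[OF sub[OF that(2)] that(1)] .
  have top: "topspace T = carrier G"
  proof -
    have "openin T (carrier G)"
      unfolding openT using \<open>N \<noteq> {}\<close> sub l_coset_subset_G[OF subgroup.subset] by (meson all_not_in_conv order_refl)
    moreover have "topspace T \<subseteq> carrier G"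
      using openin_topspace[of T] unfolding openT by blast
    ultimately show ?thesis by (meson openin_subset subset_antisym)
  qed
  have mult: "continuous_map (prod_topology T T) T (\<lambda>(x, y). x \<otimes> y)"
    unfolding continuous_map_def
  proof (intro conjI allI impI)
    show "(\<lambda>(x, y). x \<otimes> y) \<in> topspace (prod_topology T T) \<rightarrow> topspace T"
      by (auto simp: top)
    fix U assume U: "openin T U"
    show "openin (prod_topology T T)
        {z \<in> topspace (prod_topology T T). (case z of (x, y) \<Rightarrow> x \<otimes> y) \<in> U}"
      unfolding openin_prod_topology_alt
    proof (intro allI impI)
      fix x y
      assume "(x, y) \<in> {z \<in> topspace (prod_topology T T). (case z of (x, y) \<Rightarrow> x \<otimes> y) \<in> U}"
      then have xy: "x \<in> carrier G" "y \<in> carrier G" "x \<otimes> y \<in> U" by (auto simp: top)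
      then obtain H where H: "H \<in> N" "(x \<otimes> y) <#\<^bsub>G\<^esub> H \<subseteq> U" using U openT by blast
      obtain K where K: "K \<in> N" "\<And>k. k \<in> K \<Longrightarrow> inv y \<otimes> k \<otimes> y \<in> H"
        using conj[of "inv y" H] H xy by auto
      have "(x \<otimes> k) \<otimes> (y \<otimes> h) \<in> U" if "k \<in> K" "h \<in> H" for k h
      proof -
        have G: "k \<in> carrier G" "h \<in> carrier G" using that inG H K by auto
        have "(x \<otimes> k) \<otimes> (y \<otimes> h) = (x \<otimes> y) \<otimes> ((inv y \<otimes> k \<otimes> y) \<otimes> h)"
        proof -
          have "y \<otimes> (inv y \<otimes> (k \<otimes> (y \<otimes> h))) = k \<otimes> (y \<otimes> h)"
            using G xy by (simp flip: m_assoc)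
          then show ?thesis using G xy by (simp add: m_assoc)
        qed
        moreover have "(inv y \<otimes> k \<otimes> y) \<otimes> h \<in> H"
          using K H that sub by (meson subgroup.m_closed)
        ultimately show ?thesis using H coset_mem by auto
      qed
      then have "(x <#\<^bsub>G\<^esub> K) \<times> (y <#\<^bsub>G\<^esub> H) \<subseteq> {z \<in> topspace (prod_topology T T). (case z of (x, y) \<Rightarrow> x \<otimes> y) \<in> U}"
        using xy inG H K by (auto simp: top l_coset_def)
      then show "\<exists>V W. openin T V \<and> openin T W \<and> x \<in> V \<and> y \<in> W \<and>
        V \<times> W \<subseteq> {z \<in> topspace (prod_topology T T). (case z of (x, y) \<Rightarrow> x \<otimes> y) \<in> U}"
        by (intro exI[of _ "x <#\<^bsub>G\<^esub> K"] exI[of _ "y <#\<^bsub>G\<^esub> H"] conjI coset_open coset_self xy H(1) K(1))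
    qed
  qed
  have inv: "continuous_map T T (\<lambda>x. inv x)"
    unfolding continuous_map_def
  proof (intro conjI allI impI)
    show "(\<lambda>x. inv x) \<in> topspace T \<rightarrow> topspace T"
      by (auto simp: top)
    fix U assume U: "openin T U"
    have "\<exists>K \<in> N. x <#\<^bsub>G\<^esub> K \<subseteq> {x \<in> carrier G. inv x \<in> U}"
      if x: "x \<in> carrier G" "inv x \<in> U" for x
    proof -
      obtain H where H: "H \<in> N" "inv x <#\<^bsub>G\<^esub> H \<subseteq> U" using U openT x by blast
      obtain K where K: "K \<in> N" "\<And>k. k \<in> K \<Longrightarrow> x \<otimes> k \<otimes> inv x \<in> H"
        using conj[of x H] H x by auto
      have "inv (x \<otimes> k) \<in> U" if "k \<in> K" for k
      proof -
        have G: "k \<in> carrier G" using that inG K by auto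
        have "inv (x \<otimes> k) = inv x \<otimes> (x \<otimes> inv k \<otimes> inv x)"
          using G x by (simp add: inv_mult_group flip: m_assoc)
        moreover have "x \<otimes> inv k \<otimes> inv x \<in> H"
          using K that sub subgroup.m_inv_closed by metis
        ultimately show ?thesis using H coset_mem by auto
      qed
      then show ?thesis
        using x inG K by (intro bexI[of _ K]) (auto simp: l_coset_def)
    qed
    then show "openin T {x \<in> topspace T. inv x \<in> U}"
      unfolding openT top by blast
  qed
  show ?thesis
    unfolding topological_group_def T_def[symmetric] using top mult inv \<open>group G\<close> by auto
qed

section \<open>Homotopies of paths\<close>

lemma pathin_carrier: "pathin X p \<Longrightarrow> t \<in> {0..1} \<Longrightarrow> p t \<in> topspace X"
  by (auto simp: pathin_def continuous_map_def)

text \<open>Homotopies with domain the square and conditions on its four sides only, which makes values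
  of paths outside the unit interval irrelevant.\<close>

lemma path_homotopic_iff:
  "path_homotopic X p q \<longleftrightarrow>
    (\<exists>h. continuous_map (prod_topology (top_of_set {0..1::real}) (top_of_set {0..1})) X h \<and>
      (\<forall>t \<in> {0..1}. h (0, t) = p t \<and> h (1, t) = q t) \<and>
      (\<forall>s \<in> {0..1}. h (s, 0) = p 0 \<and> h (s, 1) = p 1))"
  unfolding path_homotopic_def
  by (subst homotopic_with) (auto simp: ball_conj_distrib)

lemma path_homotopic_ends:
  assumes "path_homotopic X p q"
  shows "q 0 = p 0" "q 1 = p 1"
proof -
  obtain h where "\<forall>t \<in> {0..1::real}. h (0::real, t) = p t \<and> h (1, t) = q t"
    "\<forall>s \<in> {0..1::real}. h (s, 0) = p 0 \<and> h (s, 1) = p 1"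
    using assms unfolding path_homotopic_iff by blast
  moreover have "0 \<in> {0..1::real}" "1 \<in> {0..1::real}" by auto
  ultimately show "q 0 = p 0" "q 1 = p 1" by metis+
qed

lemma path_homotopic_refl: "pathin X p \<Longrightarrow> path_homotopic X p p"
  by (simp add: path_homotopic_def pathin_def)

lemma path_homotopic_sym: "path_homotopic X p q \<Longrightarrow> path_homotopic X q p"
  using path_homotopic_ends[of X p q] unfolding path_homotopic_def
  by (auto dest: homotopic_with_symD)

lemma path_homotopic_trans [trans]:
  "path_homotopic X p q \<Longrightarrow> path_homotopic X q r \<Longrightarrow> path_homotopic X p r"
  using path_homotopic_ends[of X p q] unfolding path_homotopic_def
  by (auto intro: homotopic_with_trans)

lemma path_homotopic_imp_pathin:
  "path_homotopic X p q \<Longrightarrow> pathin X p \<and> pathin X q"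
  unfolding path_homotopic_def pathin_def
  using homotopic_with_imp_continuous_maps by blast

lemma path_homotopic_concat:
  assumes "path_homotopic X p p'" "path_homotopic X q q'" "p 1 = q 0"
  shows "path_homotopic X (p \<star> q) (p' \<star> q')"
proof -
  let ?I = "top_of_set {0..1::real}"
  let ?II = "prod_topology ?I ?I"
  obtain h where h: "continuous_map ?II X h"
      "\<And>t. t \<in> {0..1} \<Longrightarrow> h (0, t) = p t" "\<And>t. t \<in> {0..1} \<Longrightarrow> h (1, t) = p' t"
      "\<And>s. s \<in> {0..1} \<Longrightarrow> h (s, 0) = p 0" "\<And>s. s \<in> {0..1} \<Longrightarrow> h (s, 1) = p 1"
    using assms(1) unfolding path_homotopic_iff by blast
  obtain k where k: "continuous_map ?II X k"
      "\<And>t. t \<in> {0..1} \<Longrightarrow> k (0, t) = q t" "\<And>t. t \<in> {0..1} \<Longrightarrow> k (1, t) = q' t"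
      "\<And>s. s \<in> {0..1} \<Longrightarrow> k (s, 0) = q 0" "\<And>s. s \<in> {0..1} \<Longrightarrow> k (s, 1) = q 1"
    using assms(2) unfolding path_homotopic_iff by blast
  let ?H = "\<lambda>z. if snd z \<le> 1/2 then h (fst z, 2 * snd z) else k (fst z, 2 * snd z - 1)"
  have "continuous_map ?II X ?H"
  proof (rule continuous_map_cases_le)
    show "continuous_map ?II euclideanreal snd"
      by (auto intro!: continuous_intros)
    show "continuous_map ?II euclideanreal (\<lambda>z. 1/2)" by simp
    have "continuous_map (subtopology ?II {z. z \<in> topspace ?II \<and> snd z \<le> 1/2}) ?II
        (\<lambda>z. (fst z, 2 * snd z))"
      by (auto simp: subtopology_subtopology continuous_map_in_subtopology intro!: continuous_intros)
    then show "continuous_map (subtopology ?II {z. z \<in> topspace ?II \<and> snd z \<le> 1/2}) X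
        (\<lambda>z. h (fst z, 2 * snd z))"
      using continuous_map_compose[OF _ h(1)] by (auto simp: o_def)
    have "continuous_map (subtopology ?II {z. z \<in> topspace ?II \<and> 1/2 \<le> snd z}) ?II
        (\<lambda>z. (fst z, 2 * snd z - 1))"
      by (auto simp: subtopology_subtopology continuous_map_in_subtopology intro!: continuous_intros)
    then show "continuous_map (subtopology ?II {z. z \<in> topspace ?II \<and> 1/2 \<le> snd z}) X
        (\<lambda>z. k (fst z, 2 * snd z - 1))"
      using continuous_map_compose[OF _ k(1)] by (auto simp: o_def)
    show "h (fst z, 2 * snd z) = k (fst z, 2 * snd z - 1)"
      if "z \<in> topspace ?II" "snd z = 1/2" for z
    proof -
      have "2 * snd z = 1" "fst z \<in> {0..1}" using that by auto
      then show ?thesis using h(5) k(4) assms(3) by simp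
    qed
  qed
  then show ?thesis
    unfolding path_homotopic_iff using h k
    by (intro exI[of _ ?H]) (auto simp: path_concat_def)
qed

text \<open>
  The parameters \<open>f\<close> and \<open>g\<close> are joined by a straight line in the convex unit interval, and the
  homotopy is the image of that line under \<open>c\<close>. Nothing happens in \<open>X\<close>, so an arbitrary
  topology will do, and paths that retrace their steps are covered as well as monotone
  reparametrizations.
\<close>

lemma path_homotopic_reparametrization:
  assumes c: "pathin X c"
    and f: "continuous_on {0..1} f" "\<And>t. t \<in> {0..1} \<Longrightarrow> f t \<in> {0..1}"
    and g: "continuous_on {0..1} g" "\<And>t. t \<in> {0..1} \<Longrightarrow> g t \<in> {0..1}"
    and ends: "f 0 = g 0" "f 1 = g 1"
    and p: "\<And>t. t \<in> {0..1} \<Longrightarrow> p t = c (f t)"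
    and q: "\<And>t. t \<in> {0..1} \<Longrightarrow> q t = c (g t)"
  shows "path_homotopic X p q"
proof -
  let ?I = "top_of_set {0..1::real}"
  let ?II = "prod_topology ?I ?I"
  let ?m = "\<lambda>z. (1 - fst z) * f (snd z) + fst z * g (snd z)"
  have fst: "continuous_map ?II euclideanreal fst" and snd: "continuous_map ?II ?I snd"
    using continuous_map_fst[of ?I ?I] continuous_map_snd[of ?I ?I]
    by (auto simp: continuous_map_in_subtopology)
  have fg: "continuous_map ?I euclideanreal f" "continuous_map ?I euclideanreal g"
    using f g by auto
  have "continuous_map ?II euclideanreal (\<lambda>z. f (snd z))" "continuous_map ?II euclideanreal (\<lambda>z. g (snd z))"
    using continuous_map_compose[OF snd fg(1)] continuous_map_compose[OF snd fg(2)]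
    by (auto simp: o_def)
  then have "continuous_map ?II euclideanreal ?m"
    by (intro continuous_map_add continuous_map_real_mult continuous_map_diff fst) auto
  moreover have "?m z \<in> {0..1}" if "z \<in> topspace ?II" for z
  proof -
    have "fst z \<in> {0..1}" "snd z \<in> {0..1}" using that by auto
    moreover from this have "f (snd z) \<in> {0..1}" "g (snd z) \<in> {0..1}"
      using f(2) g(2) by blast+
    ultimately show ?thesis
      using convexD_alt[OF convex_real_interval(5), of "f (snd z)" 0 1 "g (snd z)" "fst z"] by simp
  qed
  ultimately have "continuous_map ?II ?I ?m" by (auto simp: continuous_map_in_subtopology)
  then have "continuous_map ?II X (c \<circ> ?m)"
    using c unfolding pathin_def by (rule continuous_map_compose)
  moreover have "(1 - s) * g 0 + s * g 0 = g 0" "(1 - s) * g 1 + s * g 1 = g 1" for s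
    by (auto simp: algebra_simps)
  ultimately show ?thesis
    unfolding path_homotopic_iff using ends p q
    by (intro exI[of _ "c \<circ> ?m"]) auto
qed

lemma path_concat_ends [simp]: "(p \<star> q) 0 = p 0" "(p \<star> q) 1 = q 1"
  by (auto simp: path_concat_def)

lemma path_reverse_ends [simp]: "path_reverse p 0 = p 1" "path_reverse p 1 = p 0"
  by (auto simp: path_reverse_def)

lemma const_path_ends [simp]: "const_path x 0 = x" "const_path x 1 = x"
  by (auto simp: const_path_def)

lemma pathin_concat: "pathin X p \<Longrightarrow> pathin X q \<Longrightarrow> p 1 = q 0 \<Longrightarrow> pathin X (p \<star> q)"
  using path_homotopic_concat path_homotopic_refl path_homotopic_imp_pathin by metis

lemma pathin_reverse: "pathin X p \<Longrightarrow> pathin X (path_reverse p)"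
  by (rule path_homotopic_imp_pathin[THEN conjunct1],
      rule path_homotopic_reparametrization[where c = p and f = "\<lambda>t. 1 - t" and g = "\<lambda>t. 1 - t"])
    (auto simp: path_reverse_def intro!: continuous_intros)

lemma path_homotopic_assoc:
  assumes "pathin X p" "pathin X q" "pathin X r" "p 1 = q 0" "q 1 = r 0"
  shows "path_homotopic X ((p \<star> q) \<star> r) (p \<star> (q \<star> r))"
proof (rule path_homotopic_reparametrization[where c = "p \<star> (q \<star> r)" and g = "\<lambda>t. t"
      and f = "\<lambda>t. min (2 * t) (min (t + 1/4) (t/2 + 1/2))"])
  \<comment> \<open>The piecewise linear map from the break points 0, 1/4, 1/2, 1 of the left bracketing to the
    break points 0, 1/2, 3/4, 1 of the right one; being concave, it is the minimum of its pieces.\<close>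
  show "pathin X (p \<star> (q \<star> r))"
    using assms by (auto intro!: pathin_concat)
  fix t :: real assume t: "t \<in> {0..1}"
  consider "t \<le> 1/4" | "1/4 < t" "t \<le> 1/2" | "1/2 < t" by linarith
  then show "((p \<star> q) \<star> r) t = (p \<star> (q \<star> r)) (min (2 * t) (min (t + 1/4) (t/2 + 1/2)))"
    using t by cases (auto simp: path_concat_def min_def algebra_simps)
qed (auto intro!: continuous_intros)

lemma path_homotopic_const_concat:
  assumes "pathin X p"
  shows "path_homotopic X (const_path (p 0) \<star> p) p"
proof (rule path_homotopic_reparametrization[where c = p and g = "\<lambda>t. t"
      and f = "\<lambda>t. max 0 (2 * t - 1)"])
  fix t :: real assume t: "t \<in> {0..1}"
  have "max 0 (2 * t - 1) = (if t \<le> 1/2 then 0 else 2 * t - 1)" by auto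
  then show "(const_path (p 0) \<star> p) t = p (max 0 (2 * t - 1))"
    using t by (auto simp: path_concat_def const_path_def)
qed (use assms in \<open>auto intro!: continuous_intros\<close>)

text \<open>Going back and forth along \<open>p\<close> is \<open>p\<close> after a map that folds the interval, and the
  interval can be unfolded onto its endpoint 1.\<close>

lemma path_homotopic_reverse_concat:
  assumes "pathin X p"
  shows "path_homotopic X (path_reverse p \<star> p) (const_path (p 1))"
proof (rule path_homotopic_reparametrization[where c = p and g = "\<lambda>t. 1"
      and f = "\<lambda>t. \<bar>2 * t - 1\<bar>"])
  fix t :: real assume t: "t \<in> {0..1}"
  have "\<bar>2 * t - 1\<bar> = (if t \<le> 1/2 then 1 - 2 * t else 2 * t - 1)" by auto
  then show "(path_reverse p \<star> p) t = p \<bar>2 * t - 1\<bar>"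
    using t by (auto simp: path_concat_def path_reverse_def)
qed (use assms in \<open>auto simp: const_path_def intro!: continuous_intros\<close>)

lemma path_reverse_reverse: "p \<in> extensional {0..1} \<Longrightarrow> path_reverse (path_reverse p) = p"
  by (auto simp: path_reverse_def fun_eq_iff extensional_def)

text \<open>An equality, not just a homotopy, because both factors take half of the time. The hypothesis
  is needed at time 1/2, where the two sides use different factors.\<close>

lemma path_reverse_concat:
  "p 1 = q 0 \<Longrightarrow> path_reverse (p \<star> q) = path_reverse q \<star> path_reverse p"
  by (auto simp: path_reverse_def path_concat_def fun_eq_iff restrict_def field_simps)

section \<open>The fundamental group\<close>

lemma paths_from_concat:
  "p \<in> paths_from X x \<Longrightarrow> q \<in> paths_from X (p 1) \<Longrightarrow> p \<star> q \<in> paths_from X x"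
  by (auto simp: paths_from_def pathin_concat) (auto simp: path_concat_def)

lemma paths_from_reverse: "p \<in> paths_from X x \<Longrightarrow> path_reverse p \<in> paths_from X (p 1)"
  by (auto simp: paths_from_def pathin_reverse) (auto simp: path_reverse_def)

lemma loops_at_concat: "p \<in> loops_at X x \<Longrightarrow> q \<in> loops_at X x \<Longrightarrow> p \<star> q \<in> loops_at X x"
  by (auto simp: loops_at_def paths_from_concat)

lemma loops_at_reverse: "p \<in> loops_at X x \<Longrightarrow> path_reverse p \<in> loops_at X x"
  using paths_from_reverse[of p X x] by (auto simp: loops_at_def paths_from_def)

lemma const_path_in_loops_at: "x \<in> topspace X \<Longrightarrow> const_path x \<in> loops_at X x"
proof -
  assume "x \<in> topspace X"
  then have "pathin X (const_path x)"
    unfolding pathin_def by (rule_tac continuous_map_eq[of _ _ "\<lambda>t. x"]) (auto simp: const_path_def)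
  then show ?thesis by (auto simp: loops_at_def paths_from_def) (simp add: const_path_def)
qed

lemma loops_at_pathin: "p \<in> loops_at X x \<Longrightarrow> pathin X p"
  by (simp add: loops_at_def paths_from_def)

lemma loops_at_ends: "p \<in> loops_at X x \<Longrightarrow> p 0 = x \<and> p 1 = x"
  by (simp add: loops_at_def paths_from_def)

lemma loop_class_self: "p \<in> loops_at X x \<Longrightarrow> p \<in> loop_class X x p"
  by (simp add: loop_class_def path_homotopic_refl loops_at_pathin)

lemma loop_class_eqI: "path_homotopic X p q \<Longrightarrow> loop_class X x p = loop_class X x q"
  unfolding loop_class_def using path_homotopic_sym path_homotopic_trans by blast

lemma mult_loop_class:
  assumes "p \<in> loops_at X x" "q \<in> loops_at X x"
  shows "loop_class X x p \<otimes>\<^bsub>fundamental_group X x\<^esub> loop_class X x q = loop_class X x (p \<star> q)"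
proof -
  have "loop_class X x (p' \<star> q') = loop_class X x (p \<star> q)"
    if "p' \<in> loop_class X x p" "q' \<in> loop_class X x q" for p' q'
  proof (rule sym, rule loop_class_eqI, rule path_homotopic_concat)
    show "path_homotopic X p p'" "path_homotopic X q q'"
      using that by (auto simp: loop_class_def)
    show "p 1 = q 0" using assms[THEN loops_at_ends] by simp
  qed
  then show ?thesis
    using loop_class_self[OF assms(1)] loop_class_self[OF assms(2)]
    unfolding fundamental_group_def monoid.simps by blast
qed

lemma carrier_fundamental_group:
  "carrier (fundamental_group X x) = loop_class X x ` loops_at X x"
  by (simp add: fundamental_group_def)

lemma one_fundamental_group: "\<one>\<^bsub>fundamental_group X x\<^esub> = loop_class X x (const_path x)"
  by (simp add: fundamental_group_def)

lemma loop_class_in_carrier: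
  "p \<in> loops_at X x \<Longrightarrow> loop_class X x p \<in> carrier (fundamental_group X x)"
  by (simp add: carrier_fundamental_group)

lemma mult_reverse_loop_class:
  assumes "p \<in> loops_at X x"
  shows "loop_class X x (path_reverse p) \<otimes>\<^bsub>fundamental_group X x\<^esub> loop_class X x p =
    \<one>\<^bsub>fundamental_group X x\<^esub>"
proof -
  have "path_homotopic X (path_reverse p \<star> p) (const_path x)"
    using path_homotopic_reverse_concat[of X p] loops_at_ends[OF assms] loops_at_pathin[OF assms] by simp
  then show ?thesis
    using assms by (simp add: mult_loop_class loops_at_reverse one_fundamental_group loop_class_eqI)
qed

lemma group_fundamental_group:
  assumes "x \<in> topspace X"
  shows "group (fundamental_group X x)"
proof (rule groupI)
  let ?G = "fundamental_group X x"
  fix A assume "A \<in> carrier ?G"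
  then obtain p where p: "p \<in> loops_at X x" "A = loop_class X x p"
    by (auto simp: carrier_fundamental_group)
  have "path_homotopic X (const_path x \<star> p) p"
    using path_homotopic_const_concat[OF loops_at_pathin[OF p(1)]] loops_at_ends[OF p(1)] by simp
  then show "\<one>\<^bsub>?G\<^esub> \<otimes>\<^bsub>?G\<^esub> A = A"
    using p assms
    by (simp add: one_fundamental_group mult_loop_class const_path_in_loops_at loop_class_eqI)
  show "\<exists>B \<in> carrier ?G. B \<otimes>\<^bsub>?G\<^esub> A = \<one>\<^bsub>?G\<^esub>"
    using p mult_reverse_loop_class loops_at_reverse loop_class_in_carrier by metis
  fix B assume "B \<in> carrier ?G"
  then obtain q where q: "q \<in> loops_at X x" "B = loop_class X x q"
    by (auto simp: carrier_fundamental_group)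
  show "A \<otimes>\<^bsub>?G\<^esub> B \<in> carrier ?G"
    using p q by (simp add: mult_loop_class loops_at_concat loop_class_in_carrier)
  fix C assume "C \<in> carrier ?G"
  then obtain r where r: "r \<in> loops_at X x" "C = loop_class X x r"
    by (auto simp: carrier_fundamental_group)
  have "path_homotopic X ((p \<star> q) \<star> r) (p \<star> (q \<star> r))"
    using p q r by (intro path_homotopic_assoc) (auto simp: loops_at_pathin loops_at_ends)
  then show "A \<otimes>\<^bsub>?G\<^esub> B \<otimes>\<^bsub>?G\<^esub> C = A \<otimes>\<^bsub>?G\<^esub> (B \<otimes>\<^bsub>?G\<^esub> C)"
    using p q r by (simp add: mult_loop_class loops_at_concat loop_class_eqI)
next
  show "\<one>\<^bsub>fundamental_group X x\<^esub> \<in> carrier (fundamental_group X x)"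
    unfolding one_fundamental_group
    using assms by (intro loop_class_in_carrier const_path_in_loops_at)
qed

lemma inv_loop_class:
  assumes "x \<in> topspace X" "p \<in> loops_at X x"
  shows "inv\<^bsub>fundamental_group X x\<^esub> (loop_class X x p) = loop_class X x (path_reverse p)"
proof -
  interpret group "fundamental_group X x" using assms(1) by (rule group_fundamental_group)
  show ?thesis
    using assms(2) loops_at_reverse[OF assms(2)]
    by (simp add: inv_equality mult_reverse_loop_class loop_class_in_carrier)
qed

section \<open>Path Spanier subgroups\<close>

lemma lasso_in_loops_at:
  assumes "\<alpha> \<in> paths_from X x" "\<beta> \<in> loops_at X (\<alpha> 1)"
  shows "\<alpha> \<star> \<beta> \<star> path_reverse \<alpha> \<in> loops_at X x"
proof -
  have "\<beta> \<star> path_reverse \<alpha> \<in> paths_from X (\<alpha> 1)"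
    using assms paths_from_reverse[OF assms(1)] by (simp add: loops_at_def paths_from_concat)
  moreover have "\<alpha> 0 = x" using assms(1) by (simp add: paths_from_def)
  ultimately show ?thesis
    using assms(1) by (simp add: loops_at_def paths_from_concat)
qed

lemma path_spanier_loops_in_loops_at:
  "p \<in> path_spanier_loops X x V \<Longrightarrow> p \<in> loops_at X x"
  by (induction rule: path_spanier_loops.induct) (auto intro: lasso_in_loops_at loops_at_concat)

lemma path_spanier_loops_mono:
  assumes "p \<in> path_spanier_loops X x V" and "\<And>\<alpha>. V \<alpha> \<subseteq> W \<alpha>"
  shows "p \<in> path_spanier_loops X x W"
  using assms(1)
proof (induction rule: path_spanier_loops.induct)
  case (single \<alpha> \<beta>)
  then show ?case using assms(2)[of \<alpha>] by (intro path_spanier_loops.single) auto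
next
  case (prod \<alpha> \<beta> \<gamma>)
  then show ?case using assms(2)[of \<alpha>] by (intro path_spanier_loops.prod) auto
qed

lemma path_homotopic_reverse_lasso:
  assumes "\<alpha> \<in> paths_from X x" "\<beta> \<in> loops_at X (\<alpha> 1)"
  shows "path_homotopic X (path_reverse (\<alpha> \<star> \<beta> \<star> path_reverse \<alpha>))
    (\<alpha> \<star> path_reverse \<beta> \<star> path_reverse \<alpha>)"
proof -
  have \<alpha>: "\<alpha> \<in> extensional {0..1}" "pathin X \<alpha>" "\<alpha> 0 = x" and \<beta>: "pathin X \<beta>" "\<beta> 0 = \<alpha> 1" "\<beta> 1 = \<alpha> 1"
    using assms by (auto simp: loops_at_def paths_from_def)
  have "path_reverse (\<alpha> \<star> \<beta> \<star> path_reverse \<alpha>) = (\<alpha> \<star> path_reverse \<beta>) \<star> path_reverse \<alpha>"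
    using \<alpha> \<beta> by (simp add: path_reverse_concat path_reverse_reverse)
  then show ?thesis
    using path_homotopic_assoc[of X \<alpha> "path_reverse \<beta>" "path_reverse \<alpha>"] \<alpha> \<beta>
    by (simp add: pathin_reverse)
qed

text \<open>The lasso along \<open>\<gamma> \<star> \<alpha>\<close> differs from the conjugate only by bracketing, as the
  reverse of \<open>\<gamma> \<star> \<alpha>\<close> is \<open>\<alpha>\<inverse> \<star> \<gamma>\<inverse>\<close>. The path \<open>\<alpha>\<close> is not a loop, so the
  rebracketing takes place among paths and not in the group.\<close>

lemma path_homotopic_conjugate_lasso:
  assumes "\<gamma> \<in> loops_at X x" "\<alpha> \<in> paths_from X x" "\<beta> \<in> loops_at X (\<alpha> 1)"
  shows "path_homotopic X (\<gamma> \<star> (\<alpha> \<star> \<beta> \<star> path_reverse \<alpha>) \<star> path_reverse \<gamma>)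
    ((\<gamma> \<star> \<alpha>) \<star> \<beta> \<star> path_reverse (\<gamma> \<star> \<alpha>))"
proof -
  let ?\<alpha>' = "path_reverse \<alpha>" and ?\<gamma>' = "path_reverse \<gamma>"
  have *: "pathin X \<gamma>" "\<gamma> 1 = \<alpha> 0" "\<gamma> 0 = \<alpha> 0" "pathin X \<alpha>" "pathin X \<beta>" "\<beta> 0 = \<alpha> 1" "\<beta> 1 = \<alpha> 1"
      "pathin X ?\<alpha>'" "pathin X ?\<gamma>'"
    using assms by (auto simp: loops_at_def paths_from_def pathin_reverse)
  note [simp] = * pathin_concat
  have "path_homotopic X ((\<alpha> \<star> \<beta> \<star> ?\<alpha>') \<star> ?\<gamma>') (\<alpha> \<star> (\<beta> \<star> ?\<alpha>') \<star> ?\<gamma>')"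
    by (rule path_homotopic_assoc) auto
  also have "path_homotopic X \<dots> (\<alpha> \<star> \<beta> \<star> ?\<alpha>' \<star> ?\<gamma>')"
    by (intro path_homotopic_concat path_homotopic_assoc path_homotopic_refl) auto
  finally have "path_homotopic X (\<gamma> \<star> (\<alpha> \<star> \<beta> \<star> ?\<alpha>') \<star> ?\<gamma>') (\<gamma> \<star> \<alpha> \<star> \<beta> \<star> ?\<alpha>' \<star> ?\<gamma>')"
    by (rule path_homotopic_concat[OF path_homotopic_refl[OF *(1)]]) auto
  also have "path_homotopic X \<dots> ((\<gamma> \<star> \<alpha>) \<star> \<beta> \<star> ?\<alpha>' \<star> ?\<gamma>')"
    by (rule path_homotopic_sym, rule path_homotopic_assoc) auto
  finally show ?thesis by (simp add: path_reverse_concat)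
qed

text \<open>A product of two products of lassos has to be rebracketed to the right before it is one of the
  loops in the inductive definition, so closure holds for classes only.\<close>

lemma path_spanier_loops_mult:
  assumes "x \<in> topspace X"
    and "p \<in> path_spanier_loops X x V" "q \<in> path_spanier_loops X x V"
  shows "loop_class X x p \<otimes>\<^bsub>fundamental_group X x\<^esub> loop_class X x q \<in> path_spanier_subgroup X x V"
  using assms(2)
proof (induction rule: path_spanier_loops.induct)
  case (single \<alpha> \<beta>)
  then have "(\<alpha> \<star> \<beta> \<star> path_reverse \<alpha>) \<star> q \<in> path_spanier_loops X x V"
    using assms(3) path_spanier_loops.prod by metis
  then show ?case
    using single assms(3)
    by (simp add: mult_loop_class lasso_in_loops_at path_spanier_loops_in_loops_at
        path_spanier_subgroup_def)
next
  case (prod \<alpha> \<beta> \<gamma>)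
  interpret group "fundamental_group X x" using assms(1) by (rule group_fundamental_group)
  let ?l = "\<alpha> \<star> \<beta> \<star> path_reverse \<alpha>"
  obtain r where r: "r \<in> path_spanier_loops X x V"
      "loop_class X x \<gamma> \<otimes>\<^bsub>fundamental_group X x\<^esub> loop_class X x q = loop_class X x r"
    using prod.IH by (auto simp: path_spanier_subgroup_def)
  have L: "?l \<in> loops_at X x" "\<gamma> \<in> loops_at X x" "q \<in> loops_at X x" "r \<in> loops_at X x"
    using prod assms(3) r by (auto intro: lasso_in_loops_at path_spanier_loops_in_loops_at)
  then have "loop_class X x (?l \<star> \<gamma>) \<otimes>\<^bsub>fundamental_group X x\<^esub> loop_class X x q = loop_class X x (?l \<star> r)"
    by (simp add: m_assoc loop_class_in_carrier r(2) flip: mult_loop_class)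
  moreover have "?l \<star> r \<in> path_spanier_loops X x V"
    using prod r by (intro path_spanier_loops.prod)
  ultimately show ?case by (simp add: path_spanier_subgroup_def)
qed

text \<open>Inverses stay in the subgroup because reversing \<open>\<beta>\<close> does not change its image. That the
  subgroup is inhabited uses \<open>\<alpha> 1 \<in> V \<alpha>\<close>: the constant loop at \<open>x\<close> lies in the set of
  the constant path.\<close>

lemma subgroup_path_spanier_subgroup:
  assumes x: "x \<in> topspace X" and V: "path_open_cover X x V"
  shows "subgroup (path_spanier_subgroup X x V) (fundamental_group X x)"
proof -
  let ?H = "path_spanier_subgroup X x V"
  interpret group "fundamental_group X x" using x by (rule group_fundamental_group)
  have closed: "A \<otimes>\<^bsub>fundamental_group X x\<^esub> B \<in> ?H" if AB: "A \<in> ?H" "B \<in> ?H" for A B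
  proof -
    obtain p q where "p \<in> path_spanier_loops X x V" "q \<in> path_spanier_loops X x V"
        "A = loop_class X x p" "B = loop_class X x q"
      using AB unfolding path_spanier_subgroup_def by blast
    then show ?thesis using path_spanier_loops_mult[OF x] by simp
  qed
  have inv_lasso: "inv\<^bsub>fundamental_group X x\<^esub> (loop_class X x (\<alpha> \<star> \<beta> \<star> path_reverse \<alpha>)) \<in> ?H"
    if "\<alpha> \<in> paths_from X x" "\<beta> \<in> loops_at X (\<alpha> 1)" "\<beta> ` {0..1} \<subseteq> V \<alpha>" for \<alpha> \<beta>
  proof -
    have "path_reverse \<beta> ` {0..1} \<subseteq> V \<alpha>"
      using that(3) by (auto simp: path_reverse_def image_subset_iff)
    then have "\<alpha> \<star> path_reverse \<beta> \<star> path_reverse \<alpha> \<in> path_spanier_loops X x V"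
      using that by (intro path_spanier_loops.single loops_at_reverse)
    then show ?thesis
      using loop_class_eqI[OF path_homotopic_reverse_lasso[OF that(1,2)], of x] that
      by (simp add: inv_loop_class[OF x] lasso_in_loops_at path_spanier_subgroup_def)
  qed
  have inv_loop: "inv\<^bsub>fundamental_group X x\<^esub> (loop_class X x p) \<in> ?H" if "p \<in> path_spanier_loops X x V" for p
    using that
  proof (induction rule: path_spanier_loops.induct)
    case (single \<alpha> \<beta>)
    then show ?case by (rule inv_lasso)
  next
    case (prod \<alpha> \<beta> \<gamma>)
    have "\<alpha> \<star> \<beta> \<star> path_reverse \<alpha> \<in> loops_at X x" "\<gamma> \<in> loops_at X x"
      using prod by (auto intro: lasso_in_loops_at path_spanier_loops_in_loops_at)
    then show ?case
      using closed[OF prod.IH inv_lasso[OF prod.hyps(1-3)]]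
      by (simp add: inv_mult_group loop_class_in_carrier flip: mult_loop_class)
  qed
  show ?thesis
  proof (rule subgroupI)
    show "?H \<subseteq> carrier (fundamental_group X x)"
      by (auto simp: path_spanier_subgroup_def intro: loop_class_in_carrier path_spanier_loops_in_loops_at)
    let ?c = "const_path x"
    have c: "?c \<in> loops_at X x" using x by (rule const_path_in_loops_at)
    then have "?c \<in> paths_from X x" by (simp add: loops_at_def)
    moreover from this have "x \<in> V ?c" using V by (auto simp: path_open_cover_def)
    then have "?c ` {0..1} \<subseteq> V ?c" by (auto simp: const_path_def)
    ultimately have "?c \<star> ?c \<star> path_reverse ?c \<in> path_spanier_loops X x V"
      using c by (intro path_spanier_loops.single) auto
    then show "?H \<noteq> {}" by (auto simp: path_spanier_subgroup_def)
  qed (use closed inv_loop in \<open>auto simp: path_spanier_subgroup_def\<close>)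
qed

text \<open>The lasso along \<open>\<gamma> \<star> \<alpha>\<close> may carry the loops in \<open>V (\<gamma> \<star> \<alpha>)\<close>, which is
  where the shifted cover comes from. Conjugation is multiplicative, so products of lassos follow.\<close>

lemma conjugate_path_spanier_subgroup:
  assumes x: "x \<in> topspace X" and V: "path_open_cover X x V" and \<gamma>: "\<gamma> \<in> loops_at X x"
    and k: "k \<in> path_spanier_subgroup X x (\<lambda>\<alpha>. V (\<gamma> \<star> \<alpha>))"
  shows "loop_class X x \<gamma> \<otimes>\<^bsub>fundamental_group X x\<^esub> k \<otimes>\<^bsub>fundamental_group X x\<^esub>
    inv\<^bsub>fundamental_group X x\<^esub> (loop_class X x \<gamma>) \<in> path_spanier_subgroup X x V"
proof -
  interpret group "fundamental_group X x" using x by (rule group_fundamental_group)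
  interpret H: subgroup "path_spanier_subgroup X x V" "fundamental_group X x"
    using x V by (rule subgroup_path_spanier_subgroup)
  let ?mult = "\<lambda>A B. A \<otimes>\<^bsub>fundamental_group X x\<^esub> B"
  let ?conj = "\<lambda>k. ?mult (?mult (loop_class X x \<gamma>) k) (inv\<^bsub>fundamental_group X x\<^esub> (loop_class X x \<gamma>))"
  have lasso: "?conj (loop_class X x (\<alpha> \<star> \<beta> \<star> path_reverse \<alpha>)) \<in> path_spanier_subgroup X x V"
    if "\<alpha> \<in> paths_from X x" "\<beta> \<in> loops_at X (\<alpha> 1)" "\<beta> ` {0..1} \<subseteq> V (\<gamma> \<star> \<alpha>)" for \<alpha> \<beta>
  proof -
    let ?l = "\<alpha> \<star> \<beta> \<star> path_reverse \<alpha>"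
    have l: "?l \<in> loops_at X x" using that by (intro lasso_in_loops_at)
    have "?conj (loop_class X x ?l) = ?mult (loop_class X x \<gamma>)
        (?mult (loop_class X x ?l) (inv\<^bsub>fundamental_group X x\<^esub> (loop_class X x \<gamma>)))"
      using l \<gamma> by (intro m_assoc inv_closed loop_class_in_carrier)
    also have "\<dots> = loop_class X x (\<gamma> \<star> ?l \<star> path_reverse \<gamma>)"
      using l \<gamma> by (simp add: inv_loop_class[OF x] mult_loop_class loops_at_reverse loops_at_concat)
    also have "\<dots> = loop_class X x ((\<gamma> \<star> \<alpha>) \<star> \<beta> \<star> path_reverse (\<gamma> \<star> \<alpha>))"
      using path_homotopic_conjugate_lasso[OF \<gamma> that(1,2)] by (rule loop_class_eqI)
    finally show ?thesis
      using that \<gamma> unfolding path_spanier_subgroup_def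
      by (auto simp: loops_at_def intro!: imageI path_spanier_loops.single paths_from_concat)
  qed
  have "?conj (loop_class X x p) \<in> path_spanier_subgroup X x V"
    if "p \<in> path_spanier_loops X x (\<lambda>\<alpha>. V (\<gamma> \<star> \<alpha>))" for p
    using that
  proof (induction rule: path_spanier_loops.induct)
    case (single \<alpha> \<beta>)
    then show ?case by (rule lasso)
  next
    case (prod \<alpha> \<beta> \<delta>)
    let ?l = "\<alpha> \<star> \<beta> \<star> path_reverse \<alpha>"
    have L: "?l \<in> loops_at X x" "\<delta> \<in> loops_at X x"
      using prod by (auto intro: lasso_in_loops_at path_spanier_loops_in_loops_at)
    then have C: "loop_class X x ?l \<in> carrier (fundamental_group X x)"
        "loop_class X x \<delta> \<in> carrier (fundamental_group X x)"
        "loop_class X x \<gamma> \<in> carrier (fundamental_group X x)"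
      using \<gamma> by (auto intro: loop_class_in_carrier)
    have "?conj (?mult a b) = ?mult (?conj a) (?conj b)"
      if "a \<in> carrier (fundamental_group X x)" "b \<in> carrier (fundamental_group X x)" for a b
      using that C(3) by (simp add: m_assoc) (simp flip: m_assoc)
    then have "?conj (loop_class X x (?l \<star> \<delta>)) = ?mult (?conj (loop_class X x ?l)) (?conj (loop_class X x \<delta>))"
      using C(1,2) by (simp flip: mult_loop_class[OF L])
    then show ?case
      using H.m_closed[OF lasso[OF prod.hyps(1-3)] prod.IH] by simp
  qed
  then show ?thesis using k by (auto simp: path_spanier_subgroup_def)
qed

theorem proposition3p11:
  fixes X :: "'a topology" and x0 :: 'a
  assumes "x0 \<in> topspace X"
  shows "topological_group (fundamental_group X x0) (path_spanier_topology X x0)"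
proof -
  let ?G = "fundamental_group X x0"
  let ?N = "path_spanier_subgroup X x0 ` {V. path_open_cover X x0 V}"
  have "topological_group ?G (topology (arbitrary union_of
      (\<lambda>B. B \<in> {g <#\<^bsub>?G\<^esub> H | g H. g \<in> carrier ?G \<and> H \<in> ?N})))"
  proof (rule topological_group_left_coset_topology)
    show "group ?G" using assms by (rule group_fundamental_group)
    have "path_open_cover X x0 (\<lambda>\<alpha>. topspace X)"
      by (auto simp: path_open_cover_def paths_from_def intro: pathin_carrier)
    then show "?N \<noteq> {}" by blast
    show "subgroup H ?G" if "H \<in> ?N" for H
      using that assms by (auto intro: subgroup_path_spanier_subgroup)
    show "\<exists>L \<in> ?N. L \<subseteq> H \<inter> K" if HK: "H \<in> ?N" "K \<in> ?N" for H K
    proof -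
      obtain V W where VW: "path_open_cover X x0 V" "path_open_cover X x0 W"
          "H = path_spanier_subgroup X x0 V" "K = path_spanier_subgroup X x0 W"
        using HK by auto
      have "path_open_cover X x0 (\<lambda>\<alpha>. V \<alpha> \<inter> W \<alpha>)"
        using VW by (auto simp: path_open_cover_def)
      moreover have "path_spanier_subgroup X x0 (\<lambda>\<alpha>. V \<alpha> \<inter> W \<alpha>) \<subseteq> H \<inter> K"
        using VW by (auto simp: path_spanier_subgroup_def intro!: imageI elim!: path_spanier_loops_mono)
      ultimately show ?thesis by blast
    qed
    show "\<exists>K \<in> ?N. \<forall>k \<in> K. g \<otimes>\<^bsub>?G\<^esub> k \<otimes>\<^bsub>?G\<^esub> inv\<^bsub>?G\<^esub> g \<in> H"
      if gH: "g \<in> carrier ?G" "H \<in> ?N" for g H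
    proof -
      obtain \<gamma> V where \<gamma>: "\<gamma> \<in> loops_at X x0" "g = loop_class X x0 \<gamma>"
        and V: "path_open_cover X x0 V" "H = path_spanier_subgroup X x0 V"
        using gH by (auto simp: carrier_fundamental_group)
      have "\<gamma> \<star> \<alpha> \<in> paths_from X x0" if "\<alpha> \<in> paths_from X x0" for \<alpha>
        using that \<gamma> by (auto simp: loops_at_def intro: paths_from_concat)
      then have "path_open_cover X x0 (\<lambda>\<alpha>. V (\<gamma> \<star> \<alpha>))"
        using V(1) unfolding path_open_cover_def by (metis path_concat_ends(2))
      then show ?thesis
        using conjugate_path_spanier_subgroup[OF assms V(1) \<gamma>(1)] \<gamma>(2) V(2) by blast
    qed
  qed
  moreover have "{g <#\<^bsub>?G\<^esub> H | g H. g \<in> carrier ?G \<and> H \<in> ?N} = path_spanier_basis X x0"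
    unfolding path_spanier_basis_def by blast
  ultimately show ?thesis by (simp add: path_spanier_topology_def)
qed

end
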